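(* Let $\gamma\in\mathbb{C}$ and consider the bi-lattice $x(s)=s+\gamma(1+(-1)^s)$ with its associated operators $\mathbf{D}_s,\mathbf{S}_s$. Let $\mathbf{u}\in\mathcal{P}^*\setminus\{\mathbf{0}\}$ and suppose that there exists $(\phi,\psi)\in(\mathcal{P}_2\times\mathcal{P}_1)\setminus\{(0,0)\}$ such that $$\mathbf{D}_s(\phi\mathbf{u})=\mathbf{S}_s(\psi\mathbf{u}).$$ Write $\phi(z)=az^2+bz+c$, $\psi(z)=dz+e$ with $a,b,c,d,e\in\mathbb{C}$, and put $d_n=an+d$, $e_n=bn+e$. Then $\mathbf{u}$ is regular if and only if $$d_n\neq0\quad\text{and}\quad \phi\left(-\frac{e_n}{d_{2n}}\right)+n\,d_n\neq0\qquad\text{for all } n=0,1,2,\ldots.$$ Under these conditions, the monic sequence of orthogonal polynomials $(P_n)_{n\ge0}$ with respect to $\mathbf{u}$ satisfies $$P_{n+1}(z)=(z-B_n)P_n(z)-C_nP_{n-1}(z)\qquad(n=0,1,\ldots),\qquad P_{-1}(z)=0,\ P_0(z)=1,$$ where, for $n=0,1,\ldots$, $$B_n=\frac{n\,e_{n-1}}{d_{2n-2}}-\frac{(n+1)e_n}{d_{2n}},\qquad C_{n+1}=-\frac{(n+1)d_{n-1}}{d_{2n-1}d_{2n+1}}\left(\phi\left(-\frac{e_n}{d_{2n}}\right)+n\,d_n\right)$$ (for $n=0$ these are understood as $B_0=-e/d$ and $C_1=-\phi(-e/d)/d_1$). Moreover, for each $n=0,1,\ldots$ the functional Rodrigues formula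 $$P_n\mathbf{u}=k_n\mathbf{D}_s^n\mathbf{u}^{[n]},\qquad k_n:=(-1)^n\prod_{j=1}^n d_{n+j-2}^{-1},$$ holds, where $\mathbf{u}^{[n]}$ are the functionals defined recursively (in the context) from $\mathbf{u},\phi,\psi$.
   Context: $\mathcal{P}$ is the space of complex polynomials in $z$, $\mathcal{P}_n$ the polynomials of degree $\le n$, $\mathcal{P}^*$ the algebraic dual of $\mathcal{P}$, $\langle\mathbf{u},f\rangle$ the action of $\mathbf{u}$ on $f$. A sequence of orthogonal polynomials with respect to $\mathbf{u}\in\mathcal{P}^*$ is a sequence $(P_n)_{n\ge0}$ with $\deg P_n=n$ and $\langle\mathbf{u},P_nP_k\rangle=h_n\delta_{n,k}$, $h_n\neq0$; $\mathbf{u}$ is regular if such a sequence exists. Operators on the bi-lattice. For $x(s)=s+\gamma(1+(-1)^s)$ set $$\mathrm{D}_sf(x(s))=\tfrac12\big(f(x(s+1))-f(x(s-1))\big),\qquad \mathrm{S}_sf(x(s))=\tfrac12\big(f(x(s+1))+f(x(s-1))\big).$$ Convention: write $z=x(s)$ and $\varepsilon=(-1)^s$, treated as a sign with $\varepsilon^2=1$. Since $x(s\pm1)=x(s)-2\gamma(-1)^s\pm1$ and $(-1)^{s\pm1}=-(-1)^s$, the operators act on the algebra $\widehat{\mathcal{P}}=E[z]$ of polynomials in $z$ whose coefficients lie in the algebra $E$ of complex functions of $\varepsilon\in\{1,-1\}$, by $$\mathrm{D}_sf(z,\varepsilon)=\tfrac12\big(f(z-2\gamma\varepsilon+1,-\varepsilon)-f(z-2\gamma\varepsilon-1,-\varepsilon)\big),$$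 $$\mathrm{S}_sf(z,\varepsilon)=\tfrac12\big(f(z-2\gamma\varepsilon+1,-\varepsilon)+f(z-2\gamma\varepsilon-1,-\varepsilon)\big).$$ Functionals are $\mathbb{C}$-linear maps $\widehat{\mathcal{P}}\to E$; $\mathbf{u}\in\mathcal{P}^*$ is viewed as such a map by extending it $E$-linearly (coefficients in $\varepsilon$ are scalars). For a functional $\mathbf{v}$ and $f,g\in\widehat{\mathcal{P}}$: $\langle f\mathbf{v},g\rangle=\langle\mathbf{v},fg\rangle$, $\langle\mathbf{D}_s\mathbf{v},f\rangle=-\langle\mathbf{v},\mathrm{D}_sf\rangle$, $\langle\mathbf{S}_s\mathbf{v},f\rangle=\langle\mathbf{v},\mathrm{S}_sf\rangle$. Given $\mathbf{u},\phi,\psi$ define $\phi^{[0]}=\phi$, $\psi^{[0]}=\psi$, $\mathbf{u}^{[0]}=\mathbf{u}$ and, for $k\ge0$, $$\phi^{[k+1]}=\mathrm{S}_s\phi^{[k]}+\mathrm{D}_s\psi^{[k]},\quad \psi^{[k+1]}=\mathrm{D}_s\phi^{[k]}+\mathrm{S}_s\psi^{[k]},\quad \mathbf{u}^{[k+1]}=\mathbf{D}_s(\psi^{[k]}\mathbf{u}^{[k]})-\mathbf{S}_s(\phi^{[k]}\mathbf{u}^{[k]}).$$ *)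

theory Defs
  imports
    Complex_Main
    "HOL-Computational_Algebra.Polynomial"
    "HOL-Library.Function_Algebras"
begin

section \<open>Regular functionals and orthogonal polynomials\<close>

definition alg_dual :: "(complex poly \<Rightarrow> complex) set" where
  "alg_dual = {u. Vector_Spaces.linear smult (*) u}"

text \<open>\<^term>\<open>degree (P 0) = 0\<close> also holds for \<^term>\<open>P 0 = 0\<close>; that degenerate case is
  excluded by \<^term>\<open>h 0 \<noteq> 0\<close>.\<close>

definition is_OPS :: "(complex poly \<Rightarrow> complex) \<Rightarrow> (nat \<Rightarrow> complex poly) \<Rightarrow> bool" where
  "is_OPS u P \<longleftrightarrow>
     (\<forall>n. degree (P n) = n) \<and>
     (\<exists>h :: nat \<Rightarrow> complex. (\<forall>n. h n \<noteq> 0) \<and>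
        (\<forall>n k. u (P n * P k) = (if n = k then h n else 0)))"

definition is_monic_OPS :: "(complex poly \<Rightarrow> complex) \<Rightarrow> (nat \<Rightarrow> complex poly) \<Rightarrow> bool" where
  "is_monic_OPS u P \<longleftrightarrow> is_OPS u P \<and> (\<forall>n. lead_coeff (P n) = 1)"

definition regular :: "(complex poly \<Rightarrow> complex) \<Rightarrow> bool" where
  "regular u \<longleftrightarrow> (\<exists>P. is_OPS u P)"

section \<open>The algebra of polynomials with coefficients depending on a sign\<close>

datatype sign = PosS | NegS

fun sign_val :: "sign \<Rightarrow> complex" where
  "sign_val PosS = 1"
| "sign_val NegS = - 1"

fun flip :: "sign \<Rightarrow> sign" where
  "flip PosS = NegS"
| "flip NegS = PosS"

text \<open>\<open>sfun\<close> is the algebra \<open>E\<close> of complex functions of \<open>\<epsilon>\<close>, with the pointwise operations of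
  \<^theory>\<open>HOL-Library.Function_Algebras\<close>; \<open>hpoly\<close> is \<open>E[z]\<close>.\<close>

type_synonym sfun = "sign \<Rightarrow> complex"
type_synonym hpoly = "sfun poly"
type_synonym functional = "hpoly \<Rightarrow> sfun"

definition cst :: "complex \<Rightarrow> sfun" where
  "cst c = (\<lambda>_. c)"

definition emb :: "complex poly \<Rightarrow> hpoly" where
  "emb p = map_poly cst p"

text \<open>\<open>slice f \<epsilon>\<close> is the complex polynomial \<open>f(\<cdot>, \<epsilon>)\<close>.\<close>

definition slice :: "hpoly \<Rightarrow> sign \<Rightarrow> complex poly" where
  "slice f s = map_poly (\<lambda>c. c s) f"

text \<open>\<open>shift \<gamma> t f\<close> is the polynomial \<open>f(z - 2 \<gamma> \<epsilon> + t, - \<epsilon>)\<close>.\<close>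

definition shift :: "complex \<Rightarrow> complex \<Rightarrow> hpoly \<Rightarrow> hpoly" where
  "shift \<gamma> t f =
     pcompose (map_poly (\<lambda>c s. c (flip s)) f) [:(\<lambda>s. - 2 * \<gamma> * sign_val s + t), 1:]"

definition D_op :: "complex \<Rightarrow> hpoly \<Rightarrow> hpoly" where
  "D_op \<gamma> f = smult (cst (1/2)) (shift \<gamma> 1 f - shift \<gamma> (- 1) f)"

definition S_op :: "complex \<Rightarrow> hpoly \<Rightarrow> hpoly" where
  "S_op \<gamma> f = smult (cst (1/2)) (shift \<gamma> 1 f + shift \<gamma> (- 1) f)"

subsection \<open>Agreement with the operators on the bi-lattice\<close>

definition bilattice :: "complex \<Rightarrow> int \<Rightarrow> complex" where
  "bilattice \<gamma> s = of_int s + \<gamma> * (1 + (- 1) powi s)"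

definition sign_of :: "int \<Rightarrow> sign" where
  "sign_of s = (if even s then PosS else NegS)"

definition on_bilattice :: "complex \<Rightarrow> hpoly \<Rightarrow> int \<Rightarrow> complex" where
  "on_bilattice \<gamma> f s = poly (slice f (sign_of s)) (bilattice \<gamma> s)"

lemma sign_val_sign_of: "sign_val (sign_of s) = (- 1) powi s"
  by (auto simp: sign_of_def power_int_minus_left)

lemma slice_pCons: "slice (pCons c f) s = pCons (c s) (slice f s)"
  unfolding slice_def by (rule map_poly_pCons) simp

lemma slice_0 [simp]: "slice 0 s = 0"
  by (simp add: slice_def)

lemma coeff_slice: "coeff (slice f s) n = coeff f n s"
  by (simp add: slice_def coeff_map_poly)

lemma slice_add: "slice (f + g) s = slice f s + slice g s"
  by (rule poly_eqI) (simp add: coeff_slice)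

lemma slice_diff: "slice (f - g) s = slice f s - slice g s"
  by (rule poly_eqI) (simp add: coeff_slice)

lemma slice_smult: "slice (smult c f) s = smult (c s) (slice f s)"
  by (rule poly_eqI) (simp add: coeff_slice)

lemma slice_mult: "slice (f * g) s = slice f s * slice g s"
  by (induction f)
    (auto simp: slice_pCons slice_add slice_smult mult_pCons_left)

lemma slice_shift:
  "slice (shift \<gamma> t f) s = pcompose (slice f (flip s)) [:- 2 * \<gamma> * sign_val s + t, 1:]"
proof (induction f)
  case 0
  show ?case by (simp add: shift_def)
next
  case (pCons c f)
  have "map_poly (\<lambda>c s. c (flip s)) (pCons c f)
      = pCons (\<lambda>s. c (flip s)) (map_poly (\<lambda>c s. c (flip s)) f)"
    by (rule map_poly_pCons) (simp add: zero_fun_def)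
  then have "shift \<gamma> t (pCons c f)
      = [:\<lambda>s. c (flip s):] + [:(\<lambda>s. - 2 * \<gamma> * sign_val s + t), 1:] * shift \<gamma> t f"
    by (simp add: shift_def pcompose_pCons)
  with pCons.IH show ?case
    by (simp add: slice_pCons slice_add slice_mult pcompose_pCons del: mult_pCons_left)
qed

lemma on_bilattice_shift:
  assumes "t = 1 \<or> t = - 1"
  shows "on_bilattice \<gamma> (shift \<gamma> (of_int t) f) s = on_bilattice \<gamma> f (s + t)"
proof -
  have "sign_of (s + t) = flip (sign_of s)"
    using assms by (auto simp: sign_of_def)
  moreover have "bilattice \<gamma> s + (- 2 * \<gamma> * sign_val (sign_of s) + of_int t) = bilattice \<gamma> (s + t)"
    using assms by (auto simp: bilattice_def sign_val_sign_of power_int_minus_left algebra_simps)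
  ultimately show ?thesis
    by (simp add: on_bilattice_def slice_shift poly_pcompose algebra_simps)
qed

lemma D_op_bilattice:
  "on_bilattice \<gamma> (D_op \<gamma> f) s
     = (1/2) * (on_bilattice \<gamma> f (s + 1) - on_bilattice \<gamma> f (s - 1))"
  using on_bilattice_shift[of 1 \<gamma> f s] on_bilattice_shift[of "- 1" \<gamma> f s]
  by (simp add: D_op_def on_bilattice_def slice_smult slice_diff cst_def)

lemma S_op_bilattice:
  "on_bilattice \<gamma> (S_op \<gamma> f) s
     = (1/2) * (on_bilattice \<gamma> f (s + 1) + on_bilattice \<gamma> f (s - 1))"
  using on_bilattice_shift[of 1 \<gamma> f s] on_bilattice_shift[of "- 1" \<gamma> f s]
  by (simp add: S_op_def on_bilattice_def slice_smult slice_add cst_def)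

section \<open>Functionals\<close>

text \<open>The \<open>E\<close>-linear extension of \<open>u\<close>: since \<open>u\<close> is linear, \<open>u (f(\<cdot>, \<epsilon>))\<close> is the value at \<open>\<epsilon>\<close> of
  the sum of \<open>u(z\<^sup>k)\<close> times the \<open>k\<close>-th coefficient of \<open>f\<close>.\<close>

definition ext :: "(complex poly \<Rightarrow> complex) \<Rightarrow> functional" where
  "ext u = (\<lambda>f s. u (slice f s))"

definition mulF :: "hpoly \<Rightarrow> functional \<Rightarrow> functional" where
  "mulF f v = (\<lambda>g. v (f * g))"

definition scaleF :: "complex \<Rightarrow> functional \<Rightarrow> functional" where
  "scaleF c v = (\<lambda>f. cst c * v f)"

definition DF :: "complex \<Rightarrow> functional \<Rightarrow> functional" where
  "DF \<gamma> v = (\<lambda>f. - v (D_op \<gamma> f))"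

definition SF :: "complex \<Rightarrow> functional \<Rightarrow> functional" where
  "SF \<gamma> v = (\<lambda>f. v (S_op \<gamma> f))"

fun phi_it :: "complex \<Rightarrow> hpoly \<Rightarrow> hpoly \<Rightarrow> nat \<Rightarrow> hpoly"
  and psi_it :: "complex \<Rightarrow> hpoly \<Rightarrow> hpoly \<Rightarrow> nat \<Rightarrow> hpoly" where
  "phi_it \<gamma> \<phi> \<psi> 0 = \<phi>"
| "phi_it \<gamma> \<phi> \<psi> (Suc k) = S_op \<gamma> (phi_it \<gamma> \<phi> \<psi> k) + D_op \<gamma> (psi_it \<gamma> \<phi> \<psi> k)"
| "psi_it \<gamma> \<phi> \<psi> 0 = \<psi>"
| "psi_it \<gamma> \<phi> \<psi> (Suc k) = D_op \<gamma> (phi_it \<gamma> \<phi> \<psi> k) + S_op \<gamma> (psi_it \<gamma> \<phi> \<psi> k)"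

fun u_it :: "complex \<Rightarrow> hpoly \<Rightarrow> hpoly \<Rightarrow> functional \<Rightarrow> nat \<Rightarrow> functional" where
  "u_it \<gamma> \<phi> \<psi> u 0 = u"
| "u_it \<gamma> \<phi> \<psi> u (Suc k) =
     DF \<gamma> (mulF (psi_it \<gamma> \<phi> \<psi> k) (u_it \<gamma> \<phi> \<psi> u k))
     - SF \<gamma> (mulF (phi_it \<gamma> \<phi> \<psi> k) (u_it \<gamma> \<phi> \<psi> u k))"

section \<open>The coefficients\<close>

text \<open>For \<open>d\<^sub>n = a n + d\<close> and \<open>e\<^sub>n = b n + e\<close> the index is an integer, because \<open>n - 1\<close>,
  \<open>2 n - 2\<close> and \<open>n + j - 2\<close> occur as indices.\<close>

definition lin_seq :: "complex \<Rightarrow> complex \<Rightarrow> int \<Rightarrow> complex" where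
  "lin_seq a d n = a * of_int n + d"

definition B_coef :: "complex \<Rightarrow> complex \<Rightarrow> complex \<Rightarrow> complex \<Rightarrow> nat \<Rightarrow> complex" where
  "B_coef a b d e n =
     (let dn = lin_seq a d; en = lin_seq b e; m = int n in
      if n = 0 then - e / d
      else of_nat n * en (m - 1) / dn (2 * m - 2) - of_nat (n + 1) * en m / dn (2 * m))"

text \<open>The value at \<open>0\<close> is arbitrary, as it only occurs as the factor of \<open>P\<^sub>-\<^sub>1 = 0\<close>; the value
  at \<open>n + 1\<close> is \<open>C\<^sub>n\<^sub>+\<^sub>1\<close>. For \<open>n = 0\<close> the factor \<open>d\<^sub>-\<^sub>1 / d\<^sub>-\<^sub>1\<close> is cancelled, since \<open>d\<^sub>-\<^sub>1\<close>
  may vanish.\<close>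

fun C_coef :: "complex \<Rightarrow> complex \<Rightarrow> complex \<Rightarrow> complex \<Rightarrow> complex \<Rightarrow> nat \<Rightarrow> complex" where
  "C_coef a b c d e 0 = 0"
| "C_coef a b c d e (Suc n) =
     (let dn = lin_seq a d; en = lin_seq b e; m = int n; \<phi> = poly [:c, b, a:] in
      if n = 0 then - \<phi> (- e / d) / dn 1
      else - (of_nat (n + 1) * dn (m - 1) / (dn (2 * m - 1) * dn (2 * m + 1)))
             * (\<phi> (- en m / dn (2 * m)) + of_nat n * dn m))"

definition k_coef :: "complex \<Rightarrow> complex \<Rightarrow> nat \<Rightarrow> complex" where
  "k_coef a d n = (- 1) ^ n * (\<Prod>j = 1..n. inverse (lin_seq a d (int n + int j - 2)))"

end

theory Submission
  imports Defs
begin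

text \<open>
  In the coordinate \<open>z - \<gamma> \<epsilon>\<close> the Pearson equation becomes
  \<open>\<langle>u, \<phi> \<Delta>g + \<psi> \<Sigma>g\<rangle> = 0\<close>, where \<open>\<Delta>\<close> and \<open>\<Sigma>\<close> are the central difference and mean with step 1.
  It says that \<open>\<langle>u, (\<phi> + \<psi>) E g\<rangle> = \<langle>u, (\<phi> - \<psi>) E\<inverse> g\<rangle>\<close> for the unit translation \<open>E\<close>, and it
  is inherited by all the iterates \<open>u\<^sub>k\<close>. Summation by parts then gives
  \<open>\<langle>u\<^sub>k\<^sub>+\<^sub>1, q \<Delta>g\<rangle> = \<langle>u\<^sub>k, (T\<^sub>k q) g\<rangle>\<close> with \<open>T\<^sub>k q = \<phi>\<^sub>k \<Delta>q + \<psi>\<^sub>k \<Sigma>q\<close>, so that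
  \<open>R\<^sub>n = T\<^sub>0 \<dots> T\<^sub>n\<^sub>-\<^sub>1 1\<close> satisfies \<open>\<langle>u, R\<^sub>n g\<rangle> = \<langle>u\<^sub>n, \<Delta>\<^sup>n g\<rangle>\<close>: this is the Rodrigues formula, and it makes
  \<open>R\<^sub>n\<close> orthogonal to all polynomials of degree below \<open>n\<close>. The two leading coefficients of \<open>R\<^sub>n\<close>
  give \<open>B\<^sub>n\<close>, and the ratio of \<open>\<langle>u\<^sub>n\<^sub>+\<^sub>1, 1\<rangle>\<close> to \<open>\<langle>u\<^sub>n, 1\<rangle>\<close> gives \<open>C\<^sub>n\<close>. Conversely, if \<open>u\<close> is regular
  and \<open>d\<^sub>n = 0\<close>, then \<open>R\<^sub>n\<^sub>+\<^sub>1\<close> has degree at most \<open>n\<close>, hence vanishes, hence \<open>u\<^sub>n\<^sub>+\<^sub>1 = 0\<close>; but \<open>u\<^sub>n\<^sub>+\<^sub>1\<close> is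
  \<open>u\<close> times a product of translates of \<open>\<phi> + \<psi>\<close>, and likewise of \<open>\<phi> - \<psi>\<close>, followed by a translation,
  which forces \<open>\<phi> = \<psi> = 0\<close>.
\<close>

section \<open>Central differences and means of complex polynomials\<close>

definition translate :: "complex \<Rightarrow> complex poly \<Rightarrow> complex poly" where
  "translate t p = pcompose p [:t, 1:]"

definition cdiff :: "complex poly \<Rightarrow> complex poly" where
  "cdiff p = smult (1/2) (translate 1 p - translate (- 1) p)"

definition cmean :: "complex poly \<Rightarrow> complex poly" where
  "cmean p = smult (1/2) (translate 1 p + translate (- 1) p)"

lemma translate_add: "translate t (p + q) = translate t p + translate t q"
  by (simp add: translate_def pcompose_add)

lemma translate_diff: "translate t (p - q) = translate t p - translate t q"
  by (simp add: translate_def pcompose_diff)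

lemma translate_mult: "translate t (p * q) = translate t p * translate t q"
  by (simp add: translate_def pcompose_mult)

lemma translate_smult: "translate t (smult c p) = smult c (translate t p)"
  by (simp add: translate_def pcompose_smult)

lemma translate_0_left [simp]: "translate 0 p = p"
  by (simp add: translate_def)

lemma translate_0_right [simp]: "translate t 0 = 0"
  by (simp add: translate_def)

lemma translate_1 [simp]: "translate t 1 = 1"
  by (simp add: translate_def one_pCons)

lemma translate_translate [simp]: "translate s (translate t p) = translate (s + t) p"
  by (simp add: translate_def pcompose_assoc [symmetric] pcompose_pCons add.commute)

lemma translate_eq_0_iff [simp]: "translate t p = 0 \<longleftrightarrow> p = 0"
proof
  assume "translate t p = 0"
  then have "translate (- t) (translate t p) = 0" by (simp only: translate_0_right)
  then show "p = 0" by simp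
qed simp

lemma translate_pCons: "translate t (pCons a p) = [:a:] + [:t, 1:] * translate t p"
  by (simp add: translate_def pcompose_pCons)

lemma smult_half_double: "smult (1/2) (p + p) = (p :: complex poly)"
  by (simp only: smult_add_right smult_add_left [symmetric]) simp

lemma cmean_plus_cdiff: "cmean p + cdiff p = translate 1 p"
  by (rule poly_eqI) (simp add: cmean_def cdiff_def field_simps)

lemma cmean_minus_cdiff: "cmean p - cdiff p = translate (- 1) p"
  by (rule poly_eqI) (simp add: cmean_def cdiff_def field_simps)

lemma cdiff_0 [simp]: "cdiff 0 = 0"
  and cmean_0 [simp]: "cmean 0 = 0"
  and cdiff_1 [simp]: "cdiff 1 = 0"
  by (simp_all add: cdiff_def cmean_def)

lemma cmean_1 [simp]: "cmean 1 = 1"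
  using cmean_plus_cdiff [of 1] by simp

lemma cdiff_add: "cdiff (p + q) = cdiff p + cdiff q"
  by (simp add: cdiff_def translate_add smult_add_right [symmetric] algebra_simps)

lemma cdiff_smult: "cdiff (smult x p) = smult x (cdiff p)"
  by (simp add: cdiff_def translate_smult smult_diff_right mult.commute)

lemma cmean_add: "cmean (p + q) = cmean p + cmean q"
  by (simp add: cmean_def translate_add smult_add_right [symmetric] algebra_simps)

lemma cmean_smult: "cmean (smult x p) = smult x (cmean p)"
  by (simp add: cmean_def translate_smult smult_add_right mult.commute)

lemma cdiff_pCons: "cdiff (pCons a p) = pCons 0 (cdiff p) + cmean p"
  by (rule poly_eqI)
    (auto simp: cdiff_def cmean_def translate_pCons coeff_pCons algebra_simps diff_divide_distrib
      add_divide_distrib split: nat.splits)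

lemma cmean_pCons: "cmean (pCons a p) = [:a:] + pCons 0 (cmean p) + cdiff p"
  by (rule poly_eqI)
    (auto simp: cdiff_def cmean_def translate_pCons coeff_pCons algebra_simps diff_divide_distrib
      add_divide_distrib split: nat.splits)

text \<open>As power series in the derivative, \<open>cdiff\<close> is sinh and \<open>cmean\<close>
  is cosh, so they differ from the derivative and the identity only by terms two orders lower. Both
  claims go through one induction because \<open>pCons\<close> couples the two operators.\<close>

lemma coeff_cdiff_cmean_top:
  assumes "\<And>j. j > m \<Longrightarrow> coeff p j = 0"
  shows "(\<forall>j. m < j + 3 \<longrightarrow> coeff (cdiff p) j = of_nat (Suc j) * coeff p (Suc j)) \<and>
         (\<forall>j. m < j + 2 \<longrightarrow> coeff (cmean p) j = coeff p j)"
  using assms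
proof (induction p arbitrary: m)
  case 0
  then show ?case by simp
next
  case (pCons a p)
  show ?case
  proof (cases m)
    case 0
    have "p = 0"
    proof (rule poly_eqI)
      show "coeff p j = coeff 0 j" for j using pCons.prems [of "Suc j"] 0 by simp
    qed
    then show ?thesis by (simp add: cdiff_pCons cmean_pCons coeff_pCons split: nat.splits)
  next
    case (Suc k)
    have van: "coeff p j = 0" if "j > k" for j
      using pCons.prems [of "Suc j"] Suc that by simp
    from pCons.IH [OF van]
    have D: "k < j + 3 \<Longrightarrow> coeff (cdiff p) j = of_nat (Suc j) * coeff p (Suc j)"
      and S: "k < j + 2 \<Longrightarrow> coeff (cmean p) j = coeff p j" for j
      by blast+
    have "coeff (cdiff (pCons a p)) j = of_nat (Suc j) * coeff (pCons a p) (Suc j)"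
      if "m < j + 3" for j
    proof (cases j)
      case 0 then show ?thesis using that Suc by (simp add: cdiff_pCons S)
    next
      case (Suc i) then show ?thesis using that \<open>m = Suc k\<close>
        by (simp add: cdiff_pCons S D algebra_simps)
    qed
    moreover have "coeff (cmean (pCons a p)) j = coeff (pCons a p) j" if "m < j + 2" for j
    proof -
      have "coeff (cdiff p) j = 0" using that Suc by (simp add: D van)
      then show ?thesis using that Suc
        by (cases j) (simp_all add: cmean_pCons S)
    qed
    ultimately show ?thesis by blast
  qed
qed

lemma coeff_cdiff_top:
  "(\<And>j. j > m \<Longrightarrow> coeff p j = 0) \<Longrightarrow> m < j + 3 \<Longrightarrow>
    coeff (cdiff p) j = of_nat (Suc j) * coeff p (Suc j)"
  using coeff_cdiff_cmean_top by blast

lemma coeff_cmean_top: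
  "(\<And>j. j > m \<Longrightarrow> coeff p j = 0) \<Longrightarrow> m < j + 2 \<Longrightarrow> coeff (cmean p) j = coeff p j"
  using coeff_cdiff_cmean_top by blast

lemma funpow_cdiff_top:
  assumes "\<And>j. j > n \<Longrightarrow> coeff p j = 0"
  shows "(cdiff ^^ n) p = [:fact n * coeff p n:]"
  using assms
proof (induction n arbitrary: p)
  case 0
  show ?case by (rule poly_eqI) (use 0 in \<open>auto simp: coeff_pCons split: nat.splits\<close>)
next
  case (Suc n)
  have "coeff (cdiff p) j = 0" if "j > n" for j
    using coeff_cdiff_top [of "Suc n" p j] Suc.prems that by simp
  from Suc.IH [OF this] have "(cdiff ^^ n) (cdiff p) = [:fact n * coeff (cdiff p) n:]" .
  moreover have "coeff (cdiff p) n = of_nat (Suc n) * coeff p (Suc n)"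
    by (rule coeff_cdiff_top [of "Suc n"]) (use Suc.prems in auto)
  ultimately show ?case
    by (simp add: funpow_swap1 algebra_simps)
qed

lemma surj_cdiff: "\<exists>q. p = cdiff q"
proof -
  have "\<forall>j\<ge>n. coeff p j = 0 \<Longrightarrow> \<exists>q. p = cdiff q" for n
  proof (induction n arbitrary: p)
    case 0
    then have "p = 0" by (simp add: poly_eqI)
    then show ?case using cdiff_0 by metis
  next
    case (Suc n)
    \<comment> \<open>The difference of this monomial has leading coefficient
      \<open>coeff p n\<close>, so subtracting it lowers the degree bound.\<close>
    define q where "q = monom (coeff p n / of_nat (Suc n)) (Suc n)"
    have "coeff (p - cdiff q) j = 0" if "j \<ge> n" for j
    proof -
      have "coeff (cdiff q) j = of_nat (Suc j) * coeff q (Suc j)"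
        by (rule coeff_cdiff_top [of "Suc n"]) (use that in \<open>auto simp: q_def\<close>)
      then show ?thesis using Suc.prems that
        by (cases "j = n") (simp_all add: q_def nonzero_mult_div_cancel_left del: of_nat_Suc)
    qed
    from Suc.IH [of "p - cdiff q"] this obtain r where "p - cdiff q = cdiff r" by blast
    then have "p = cdiff (q + r)" by (simp add: cdiff_add algebra_simps)
    then show ?case by blast
  qed
  from this [of "Suc (degree p)"] show ?thesis by (simp add: coeff_eq_0)
qed

lemma surj_funpow_cdiff: "\<exists>q. p = (cdiff ^^ n) q"
proof (induction n)
  case (Suc n)
  then obtain q where "p = (cdiff ^^ n) q" by blast
  moreover obtain r where "q = cdiff r" using surj_cdiff by blast
  ultimately show ?case by (auto simp: funpow_swap1)
qed simp

section \<open>Orthogonality\<close>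

lemma cancel_lead_coeff:
  fixes r q :: "complex poly"
  assumes "\<forall>j\<ge>Suc k. coeff r j = 0" "degree q = k" "coeff q k \<noteq> 0"
  shows "\<forall>j\<ge>k. coeff (r - smult (coeff r k / coeff q k) q) j = 0"
proof (intro allI impI)
  fix j assume "j \<ge> k"
  then show "coeff (r - smult (coeff r k / coeff q k) q) j = 0"
    using assms by (cases "j = k") (simp_all add: coeff_eq_0)
qed

locale poly_functional =
  fixes L :: "complex poly \<Rightarrow> complex"
  assumes add: "L (p + q) = L p + L q"
    and smult: "L (smult c p) = c * L p"
begin

lemma zero [simp]: "L 0 = 0"
  using smult [of 0 0] by simp

lemma uminus: "L (- p) = - L p"
  using smult [of "- 1" p] by simp

lemma diff: "L (p - q) = L p - L q"
  using add [of p "- q"] by (simp add: uminus)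

lemma const: "L [:x:] = x * L 1"
  using smult [of x 1] by simp

lemma OPS_lead_coeff_nonzero:
  assumes "is_OPS L P" shows "coeff (P n) n \<noteq> 0"
proof -
  have "L (P n * P n) \<noteq> 0" using assms by (auto simp: is_OPS_def)
  then have "P n \<noteq> 0" by auto
  moreover have "degree (P n) = n" using assms by (simp add: is_OPS_def)
  ultimately show ?thesis by (metis leading_coeff_0_iff)
qed

lemma OPS_orthogonal:
  assumes "is_OPS L P" "k \<le> n" "\<forall>j\<ge>k. coeff r j = 0"
  shows "L (P n * r) = 0"
  using assms(2-)
proof (induction k arbitrary: r)
  case 0
  then have "r = 0" by (simp add: poly_eqI)
  then show ?case by simp
next
  case (Suc k)
  have deg: "degree (P k) = k" and orth: "L (P n * P k) = 0"
    using assms(1) Suc.prems(1) unfolding is_OPS_def by (blast, fastforce)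
  have lead: "coeff (P k) k \<noteq> 0" using assms(1) by (rule OPS_lead_coeff_nonzero)
  define r' where "r' = r - smult (coeff r k / coeff (P k) k) (P k)"
  have "\<forall>j\<ge>k. coeff r' j = 0"
    unfolding r'_def by (rule cancel_lead_coeff [OF Suc.prems(2) deg lead])
  with Suc have "L (P n * r') = 0" by simp
  moreover have "P n * r = P n * r' + smult (coeff r k / coeff (P k) k) (P n * P k)"
    by (simp add: r'_def algebra_simps)
  ultimately show ?case by (simp add: add smult orth)
qed

text \<open>Pairing \<open>r\<close> with \<open>P k\<close> isolates its top coefficient, which
  must therefore vanish; the bound then descends to 0. The later arguments that a polynomial is zero
  all go through this. Degree bounds are stated by coefficients so that the zero polynomial and
  \<open>k = 0\<close> fit in.\<close>

lemma OPS_nondegenerate: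
  assumes "is_OPS L P" "\<forall>j\<ge>k. coeff r j = 0"
    and "\<And>g. \<forall>j\<ge>k. coeff g j = 0 \<Longrightarrow> L (r * g) = 0"
  shows "r = 0"
  using assms(2-)
proof (induction k)
  case 0
  then show ?case by (simp add: poly_eqI)
next
  case (Suc k)
  have deg: "degree (P k) = k" and nz: "L (P k * P k) \<noteq> 0"
    using assms(1) unfolding is_OPS_def by (blast, fastforce)
  have lead: "coeff (P k) k \<noteq> 0" using assms(1) by (rule OPS_lead_coeff_nonzero)
  define x where "x = coeff r k / coeff (P k) k"
  define r' where "r' = r - smult x (P k)"
  have "\<forall>j\<ge>k. coeff r' j = 0"
    unfolding r'_def x_def by (rule cancel_lead_coeff [OF Suc.prems(1) deg lead])
  then have "L (P k * r') = 0" by (rule OPS_orthogonal [OF assms(1) le_refl])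
  moreover have "L (r * P k) = 0"
    using Suc.prems(2) [of "P k"] deg by (simp add: coeff_eq_0)
  moreover have "r * P k = P k * r' + smult x (P k * P k)"
    by (simp add: r'_def algebra_simps)
  ultimately have "x = 0" using nz by (simp add: add smult)
  then have "coeff r k = 0" using lead by (simp add: x_def)
  then have "\<forall>j\<ge>k. coeff r j = 0" using Suc.prems(1) by (metis le_antisym not_less_eq_eq)
  then show ?case using Suc.prems(2) by (intro Suc.IH) auto
qed

lemma monic_OPS_unique:
  assumes "is_monic_OPS L P" "is_monic_OPS L Q"
  shows "P = Q"
proof
  fix n
  have P: "is_OPS L P" "degree (P n) = n" "coeff (P n) n = 1"
    and Q: "is_OPS L Q" "degree (Q n) = n" "coeff (Q n) n = 1"
    using assms by (metis is_OPS_def is_monic_OPS_def)+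
  have "P n - Q n = 0"
  proof (rule OPS_nondegenerate [OF P(1), where k = n])
    show "\<forall>j\<ge>n. coeff (P n - Q n) j = 0"
      using P Q by (auto simp: coeff_eq_0 le_less)
    show "L ((P n - Q n) * g) = 0" if "\<forall>j\<ge>n. coeff g j = 0" for g
      using OPS_orthogonal [OF P(1) le_refl that] OPS_orthogonal [OF Q(1) le_refl that]
      by (simp add: left_diff_distrib diff)
  qed
  then show "P n = Q n" by simp
qed

end

section \<open>Functionals satisfying a Pearson-type equation\<close>

locale pearson_functional = poly_functional L
  for L :: "complex poly \<Rightarrow> complex" +
  fixes a b c d e :: complex
  assumes pearson: "L ([:c, b, a:] * cdiff g) + L ([:e, d:] * cmean g) = 0"
begin

abbreviation "dn \<equiv> lin_seq a d"
abbreviation "en \<equiv> lin_seq b e"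

text \<open>Closed forms of the iterates of \<phi> and \<psi> in the recentred coordinate;
  \<open>Phi_Suc\<close> and \<open>Psi_Suc\<close> confirm the defining recursion.\<close>

definition Phi :: "nat \<Rightarrow> complex poly" where
  "Phi k = [:c + of_nat k * dn (int k), b, a:]"

definition Psi :: "nat \<Rightarrow> complex poly" where
  "Psi k = [:en (int k), dn (2 * int k):]"

lemma translate_sum: "translate 1 (Phi k + Psi k) = Phi (Suc k) + Psi (Suc k)"
  by (simp add: translate_def Phi_def Psi_def pcompose_pCons lin_seq_def algebra_simps)

lemma translate_difference: "translate (- 1) (Phi k - Psi k) = Phi (Suc k) - Psi (Suc k)"
  by (simp add: translate_def Phi_def Psi_def pcompose_pCons lin_seq_def algebra_simps)

lemma Phi_Suc: "cmean (Phi k) + cdiff (Psi k) = Phi (Suc k)"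
  by (simp add: cmean_pCons cdiff_pCons Phi_def Psi_def lin_seq_def algebra_simps)

lemma Psi_Suc: "cdiff (Phi k) + cmean (Psi k) = Psi (Suc k)"
  by (simp add: cmean_pCons cdiff_pCons Phi_def Psi_def lin_seq_def algebra_simps)

section \<open>The iterated functionals and the exchange of translates\<close>

primrec U :: "nat \<Rightarrow> complex poly \<Rightarrow> complex" where
  "U 0 g = L g"
| "U (Suc k) g = - U k (Psi k * cdiff g) - U k (Phi k * cmean g)"

lemma poly_functional_U: "poly_functional (U k)"
proof (induction k)
  case 0
  have "U 0 = L" by (simp add: fun_eq_iff)
  then show ?case using poly_functional_axioms by simp
next
  case (Suc k)
  interpret U: poly_functional "U k" by fact
  show ?case
    by unfold_locales
      (simp_all add: cdiff_add cmean_add cdiff_smult cmean_smult ring_distribs U.add U.smult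
        mult_smult_right right_diff_distrib)
qed

interpretation U: poly_functional "U k" for k
  by (rule poly_functional_U)

lemma Phi_cdiff_Psi_cmean:
  "Phi k * cdiff g + Psi k * cmean g
     = smult (1/2) ((Phi k + Psi k) * translate 1 g - (Phi k - Psi k) * translate (- 1) g)"
proof -
  have "(Phi k + Psi k) * (cmean g + cdiff g) - (Phi k - Psi k) * (cmean g - cdiff g)
      = (Phi k * cdiff g + Psi k * cmean g) + (Phi k * cdiff g + Psi k * cmean g)"
    by (simp add: algebra_simps)
  then show ?thesis
    unfolding cmean_plus_cdiff [symmetric] cmean_minus_cdiff [symmetric]
    by (simp only: smult_half_double)
qed

lemma Psi_cdiff_Phi_cmean:
  "Psi k * cdiff g + Phi k * cmean g
     = smult (1/2) ((Phi k + Psi k) * translate 1 g + (Phi k - Psi k) * translate (- 1) g)"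
proof -
  have "(Phi k + Psi k) * (cmean g + cdiff g) + (Phi k - Psi k) * (cmean g - cdiff g)
      = (Psi k * cdiff g + Phi k * cmean g) + (Psi k * cdiff g + Phi k * cmean g)"
    by (simp add: algebra_simps)
  then show ?thesis
    unfolding cmean_plus_cdiff [symmetric] cmean_minus_cdiff [symmetric]
    by (simp only: smult_half_double)
qed

text \<open>The exchange property is a hypothesis here because the induction proving it needs this
  formula at the preceding level.\<close>

lemma U_Suc_if_exchange:
  assumes "U k ((Phi k + Psi k) * translate 1 g) = U k ((Phi k - Psi k) * translate (- 1) g)"
  shows "U (Suc k) g = - U k ((Phi k + Psi k) * translate 1 g)"
proof -
  have "U (Suc k) g = - U k (Psi k * cdiff g + Phi k * cmean g)" by (simp add: U.add)
  also have "\<dots> = - U k ((Phi k + Psi k) * translate 1 g)"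
    unfolding Psi_cdiff_Phi_cmean U.smult U.add assms by simp
  finally show ?thesis .
qed

text \<open>The Pearson equation is inherited by \<open>U k\<close>, because the two factors
  \<open>Phi k \<plusminus> Psi k\<close> are translates of \<open>Phi 0 \<plusminus> Psi 0\<close> in opposite directions.\<close>

lemma U_exchange:
  "U k ((Phi k + Psi k) * translate 1 g) = U k ((Phi k - Psi k) * translate (- 1) g)"
proof (induction k arbitrary: g)
  case 0
  have "L (Phi 0 * cdiff g + Psi 0 * cmean g) = 0"
    using pearson [of g] by (simp add: add Phi_def Psi_def lin_seq_def)
  then show ?case
    unfolding Phi_cdiff_Psi_cmean smult diff by simp
next
  case (Suc k)
  note exch = Suc and step = U_Suc_if_exchange [OF Suc]
  have "U (Suc k) ((Phi (Suc k) + Psi (Suc k)) * translate 1 g)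
      = - U k ((Phi k - Psi k) * translate (- 1) ((Phi (Suc k) + Psi (Suc k)) * translate 1 g))"
    by (simp only: step exch)
  also have "translate (- 1) ((Phi (Suc k) + Psi (Suc k)) * translate 1 g) = (Phi k + Psi k) * g"
    unfolding translate_sum [symmetric] translate_mult by simp
  \<comment> \<open>The product is symmetric in the two factors, so it can be regrouped around the
    opposite translation.\<close>
  also have "(Phi k - Psi k) * ((Phi k + Psi k) * g)
      = (Phi k + Psi k) * translate 1 ((Phi (Suc k) - Psi (Suc k)) * translate (- 1) g)"
    unfolding translate_difference [symmetric] translate_mult by simp
  also have "- U k \<dots> = U (Suc k) ((Phi (Suc k) - Psi (Suc k)) * translate (- 1) g)"
    by (simp only: step)
  finally show ?case .
qed

lemma U_Suc_plus: "U (Suc k) g = - U k ((Phi k + Psi k) * translate 1 g)"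
  by (rule U_Suc_if_exchange [OF U_exchange])

lemma U_Suc_minus: "U (Suc k) g = - U k ((Phi k - Psi k) * translate (- 1) g)"
  by (simp only: U_Suc_plus U_exchange)

section \<open>Raising operators and summation by parts\<close>

definition raise :: "nat \<Rightarrow> complex poly \<Rightarrow> complex poly" where
  "raise k q = Phi k * cdiff q + Psi k * cmean q"

text \<open>Each translate of \<open>g\<close> is met with the form of \<open>U (Suc k)\<close> that
  translates the opposite way, which moves the translation onto \<open>q\<close> and leaves
  \<open>g\<close> fixed.\<close>

lemma U_Suc_cdiff: "U (Suc k) (q * cdiff g) = U k (raise k q * g)"
proof -
  have "q * cdiff g = smult (1/2) (q * translate 1 g - q * translate (- 1) g)"
    by (simp add: cdiff_def right_diff_distrib)
  then have "U (Suc k) (q * cdiff g)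
      = (1/2) * (U (Suc k) (q * translate 1 g) - U (Suc k) (q * translate (- 1) g))"
    by (simp only: U.smult U.diff)
  also have "U (Suc k) (q * translate 1 g) = - U k ((Phi k - Psi k) * translate (- 1) q * g)"
    unfolding U_Suc_minus translate_mult by (simp add: mult.assoc)
  also have "U (Suc k) (q * translate (- 1) g) = - U k ((Phi k + Psi k) * translate 1 q * g)"
    unfolding U_Suc_plus translate_mult by (simp add: mult.assoc)
  finally show ?thesis
    unfolding raise_def Phi_cdiff_Psi_cmean mult_smult_left left_diff_distrib U.smult U.diff
    by simp
qed

primrec R :: "nat \<Rightarrow> nat \<Rightarrow> complex poly" where
  "R k 0 = 1"
| "R k (Suc m) = raise k (R (Suc k) m)"

lemma U_funpow_cdiff: "U (k + m) ((cdiff ^^ m) g) = U k (R k m * g)"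
proof (induction m arbitrary: k g)
  case (Suc m)
  have "U (k + Suc m) ((cdiff ^^ Suc m) g) = U (Suc k + m) ((cdiff ^^ m) (cdiff g))"
    by (simp add: funpow_swap1)
  also have "\<dots> = U (Suc k) (R (Suc k) m * cdiff g)" by (rule Suc)
  finally show ?case by (simp only: U_Suc_cdiff R.simps)
qed simp

text \<open>Only the two top coefficients of \<open>cdiff q\<close> and \<open>cmean q\<close>
  enter, so \<open>raise k\<close> acts here like the differential operator sending \<open>q\<close>
  to \<open>Phi k\<close> times its derivative plus \<open>Psi k * q\<close>.\<close>

lemma coeff_raise_top:
  assumes "\<And>j. j > m \<Longrightarrow> coeff q j = 0"
  shows "j > Suc m \<Longrightarrow> coeff (raise k q) j = 0"
    and "coeff (raise k q) (Suc m) = dn (2 * int k + int m) * coeff q m"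
    and "m > 0 \<Longrightarrow> coeff (raise k q) m
      = dn (2 * int k + int m - 1) * coeff q (m - 1) + en (int k + int m) * coeff q m"
proof -
  note D = coeff_cdiff_top [OF assms] and S = coeff_cmean_top [OF assms]
  have expand: "coeff (raise k q) (Suc j)
      = (c + of_nat k * dn (int k)) * coeff (cdiff q) (Suc j) + b * coeff (cdiff q) j
        + a * (case j of 0 \<Rightarrow> 0 | Suc i \<Rightarrow> coeff (cdiff q) i)
        + en (int k) * coeff (cmean q) (Suc j) + dn (2 * int k) * coeff (cmean q) j" for j
    by (simp add: raise_def Phi_def Psi_def coeff_pCons split: nat.splits)
  show "coeff (raise k q) j = 0" if "j > Suc m"
  proof -
    from that obtain i where i: "j = Suc (Suc i)" "i \<ge> m"
      by (metis Suc_lessE Suc_less_eq less_Suc_eq_le less_imp_Suc_add)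
    then show ?thesis by (simp add: expand D S assms)
  qed
  show "coeff (raise k q) (Suc m) = dn (2 * int k + int m) * coeff q m"
    by (cases m) (simp_all add: expand D S assms lin_seq_def algebra_simps)
  show "coeff (raise k q) m
      = dn (2 * int k + int m - 1) * coeff q (m - 1) + en (int k + int m) * coeff q m"
    if "m > 0"
  proof -
    from that obtain i where i: "m = Suc i" by (cases m) auto
    show ?thesis unfolding i expand
      by (cases i) (simp_all add: D S assms i lin_seq_def algebra_simps)
  qed
qed

section \<open>Leading coefficients, orthogonality and norms of the Rodrigues polynomials\<close>

lemma coeff_R_above: "j > m \<Longrightarrow> coeff (R k m) j = 0"
proof (induction m arbitrary: k j)
  case 0 then show ?case by (simp add: coeff_eq_0)
next
  case (Suc m)
  show ?case unfolding R.simps by (rule coeff_raise_top(1)) (use Suc in auto)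
qed

lemma coeff_R_lead: "coeff (R k m) m = (\<Prod>i<m. dn (2 * int k + int m - 1 + int i))"
proof (induction m arbitrary: k)
  case (Suc m)
  have "coeff (R k (Suc m)) (Suc m) = dn (2 * int k + int m) * coeff (R (Suc k) m) m"
    unfolding R.simps by (rule coeff_raise_top(2)) (rule coeff_R_above)
  also have "\<dots> = (\<Prod>i<Suc m. dn (2 * int k + int (Suc m) - 1 + int i))"
    unfolding Suc prod.lessThan_Suc_shift by (simp add: algebra_simps)
  finally show ?case .
qed simp

text \<open>Stated without division, since values of \<open>dn\<close> may still vanish here. The
  sums \<open>k + m\<close> in the indices are unchanged when the induction trades one step of
  \<open>m\<close> for one of \<open>k\<close>.\<close>

lemma coeff_R_second:
  "coeff (R k (Suc m)) m * dn (2 * int k + 2 * int m)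
     = of_nat (Suc m) * en (int k + int m) * coeff (R k (Suc m)) (Suc m)"
proof (induction m arbitrary: k)
  case 0
  then show ?case by (simp add: raise_def Psi_def)
next
  case (Suc m)
  define q where "q = R (Suc k) (Suc m)"
  have above: "coeff q j = 0" if "j > Suc m" for j
    using that by (simp add: q_def coeff_R_above del: R.simps)
  have IH: "coeff q m * dn (2 * int k + 2 * int m + 2)
      = of_nat (Suc m) * en (int k + int m + 1) * coeff q (Suc m)"
    using Suc [of "Suc k"] by (simp add: q_def algebra_simps del: R.simps)
  have 1: "coeff (R k (Suc (Suc m))) (Suc (Suc m)) = dn (2 * int k + int m + 1) * coeff q (Suc m)"
    using coeff_raise_top(2) [where k = k, OF above]
    by (simp add: q_def algebra_simps)
  have 2: "coeff (R k (Suc (Suc m))) (Suc m)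
      = dn (2 * int k + int m) * coeff q m + en (int k + int m + 1) * coeff q (Suc m)"
    using coeff_raise_top(3) [where k = k, OF above]
    by (simp add: q_def algebra_simps)
  have "coeff (R k (Suc (Suc m))) (Suc m) * dn (2 * int k + 2 * int m + 2)
      = dn (2 * int k + int m) * (coeff q m * dn (2 * int k + 2 * int m + 2))
        + en (int k + int m + 1) * coeff q (Suc m) * dn (2 * int k + 2 * int m + 2)"
    unfolding 2 by (simp add: algebra_simps)
  \<comment> \<open>With \<open>K = 2 * k + m\<close> this rests on
    \<open>(m + 1) * dn K + dn (K + m + 2) = (m + 2) * dn (K + 1)\<close>.\<close>
  also have "\<dots> = of_nat (Suc (Suc m)) * en (int k + int m + 1)
      * (dn (2 * int k + int m + 1) * coeff q (Suc m))"
    unfolding IH by (simp add: lin_seq_def algebra_simps)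
  finally show ?case unfolding 1 by (simp add: algebra_simps del: R.simps)
qed

lemma R_orthogonal:
  assumes "\<forall>j\<ge>n. coeff g j = 0"
  shows "L (R 0 n * g) = 0"
proof -
  have "(cdiff ^^ n) g = [:fact n * coeff g n:]"
    by (rule funpow_cdiff_top) (use assms in auto)
  then have "U (0 + n) ((cdiff ^^ n) g) = 0" using assms by simp
  then show ?thesis unfolding U_funpow_cdiff by simp
qed

text \<open>The \<open>n\<close>-fold difference of \<open>g\<close> is the constant
  \<open>fact n * coeff g n\<close>, so the pairing only sees the value of \<open>U n\<close> at
  1.\<close>

lemma R_norm:
  assumes "\<And>j. j > n \<Longrightarrow> coeff g j = 0"
  shows "L (R 0 n * g) = fact n * coeff g n * U n 1"
proof -
  have "(cdiff ^^ n) g = [:fact n * coeff g n:]"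
    by (rule funpow_cdiff_top) (use assms in auto)
  then have "U (0 + n) ((cdiff ^^ n) g) = fact n * coeff g n * U n 1"
    by (simp add: U.const del: U.simps)
  then show ?thesis unfolding U_funpow_cdiff by simp
qed

text \<open>Division of \<open>Phi n\<close> by \<open>Psi n\<close> leaves the value of
  \<open>Phi n\<close> at the root of \<open>Psi n\<close>. Summation by parts with
  \<open>q = 1\<close> and \<open>g = z\<close> or \<open>g = 1\<close> evaluates the two multiples
  of \<open>Psi n\<close>.\<close>

lemma U_Suc_one:
  assumes "dn (2 * int n) \<noteq> 0"
  shows "dn (2 * int n + 1) * U (Suc n) 1
    = - dn (2 * int n) * poly (Phi n) (- en (int n) / dn (2 * int n)) * U n 1"
proof -
  define x where "x = - en (int n) / dn (2 * int n)"
  have psi: "Psi n = smult (dn (2 * int n)) [:- x, 1:]"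
    using assms by (simp add: Psi_def x_def)
  have PhiU: "U (Suc n) 1 = - U n (Phi n)" by simp
  have "U (Suc n) (cdiff [:0, 1:]) = U n (raise n 1 * [:0, 1:])"
    using U_Suc_cdiff [of n 1] by simp
  moreover have "cdiff [:0, 1:] = 1" by (simp add: cdiff_pCons cmean_pCons one_pCons)
  ultimately have rel: "U n (Psi n * [:0, 1:]) = U (Suc n) 1"
    by (simp add: raise_def)
  have "U (Suc n) (cdiff 1) = U n (raise n 1 * 1)"
    using U_Suc_cdiff [of n 1 1] by simp
  then have rel0: "U n (Psi n) = 0" by (simp add: raise_def)
  have "smult (dn (2 * int n)) (Phi n)
      = smult a (Psi n * [:0, 1:]) + smult (b + a * x) (Psi n)
        + [:dn (2 * int n) * poly (Phi n) x:]"
    unfolding psi Phi_def by (simp add: algebra_simps)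
  then have "dn (2 * int n) * U n (Phi n)
      = a * U n (Psi n * [:0, 1:]) + (b + a * x) * U n (Psi n)
        + dn (2 * int n) * poly (Phi n) x * U n 1"
    by (metis U.add U.smult U.const)
  then have main: "dn (2 * int n) * U n (Phi n)
      = a * U (Suc n) 1 + dn (2 * int n) * poly (Phi n) x * U n 1"
    unfolding rel rel0 by simp
  \<comment> \<open>The term with factor \<open>a\<close> is absorbed by
    \<open>dn (2 * n + 1) = dn (2 * n) + a\<close>.\<close>
  have "dn (2 * int n + 1) * U (Suc n) 1 = a * U (Suc n) 1 - dn (2 * int n) * U n (Phi n)"
    unfolding PhiU by (simp add: lin_seq_def algebra_simps)
  then show ?thesis unfolding main x_def by simp
qed

section \<open>Nonvanishing of \<open>dn\<close> and of \<open>L 1\<close>\<close>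

lemma U_as_product:
  assumes "[:c, b, a:] \<noteq> 0 \<or> [:e, d:] \<noteq> 0"
  shows "\<exists>p t. p \<noteq> 0 \<and> (\<forall>g. U k g = L (p * translate t g))"
proof -
  have 0: "Phi 0 = [:c, b, a:]" "Psi 0 = [:e, d:]"
    by (simp_all add: Phi_def Psi_def lin_seq_def)
  \<comment> \<open>Whichever of the two combinations is nonzero selects the one-sided formula for
    \<open>U (Suc k)\<close>; \<open>p\<close> then collects translates of it, none of which
    vanishes.\<close>
  have "Phi 0 + Psi 0 \<noteq> 0 \<or> Phi 0 - Psi 0 \<noteq> 0"
  proof (rule ccontr)
    assume *: "\<not> ?thesis"
    then have eq: "Phi 0 = Psi 0" by simp
    have double: "Psi 0 + Psi 0 = 0" using * unfolding eq by blast
    have "Psi 0 = 0" using smult_half_double [of "Psi 0"] unfolding double by simp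
    with eq have "Psi 0 = 0" "Phi 0 = 0" by simp_all
    then show False using assms unfolding 0 by simp
  qed
  then show ?thesis
  proof
    assume nz: "Phi 0 + Psi 0 \<noteq> 0"
    have nz: "Phi k + Psi k \<noteq> 0" for k
      by (induction k) (use nz in \<open>auto simp flip: translate_sum\<close>)
    show ?thesis
    proof (induction k)
      case 0
      show ?case by (rule exI [of _ 1], rule exI [of _ 0]) simp
    next
      case (Suc k)
      then obtain p t where p: "p \<noteq> 0" "\<And>g. U k g = L (p * translate t g)" by blast
      have "U (Suc k) g = L (- (p * translate t (Phi k + Psi k)) * translate (t + 1) g)" for g
        unfolding U_Suc_plus p(2) translate_mult by (simp add: uminus mult.assoc)
      moreover have "- (p * translate t (Phi k + Psi k)) \<noteq> 0" using p nz by simp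
      ultimately show ?case by blast
    qed
  next
    assume nz: "Phi 0 - Psi 0 \<noteq> 0"
    have nz: "Phi k - Psi k \<noteq> 0" for k
    proof (induction k)
      case 0 show ?case by (fact nz)
    next
      case (Suc k)
      then have "translate (- 1) (Phi k - Psi k) \<noteq> 0" by (subst translate_eq_0_iff)
      then show ?case unfolding translate_difference .
    qed
    show ?thesis
    proof (induction k)
      case 0
      show ?case by (rule exI [of _ 1], rule exI [of _ 0]) simp
    next
      case (Suc k)
      then obtain p t where p: "p \<noteq> 0" "\<And>g. U k g = L (p * translate t g)" by blast
      have "U (Suc k) g = L (- (p * translate t (Phi k - Psi k)) * translate (t + - 1) g)" for g
        unfolding U_Suc_minus p(2) translate_mult translate_translate
        by (simp add: uminus mult.assoc)
      moreover have "- (p * translate t (Phi k - Psi k)) \<noteq> 0"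
        unfolding neg_equal_0_iff_equal mult_eq_0_iff translate_eq_0_iff using p(1) nz by blast
      ultimately show ?case by blast
    qed
  qed
qed

lemma regular_imp_dn_nonzero:
  assumes "regular L" and nz: "[:c, b, a:] \<noteq> 0 \<or> [:e, d:] \<noteq> 0"
  shows "dn (int n) \<noteq> 0"
proof
  assume dn0: "dn (int n) = 0"
  obtain P where P: "is_OPS L P" using assms(1) by (auto simp: regular_def)
  \<comment> \<open>The first factor of the leading coefficient is \<open>dn n\<close>.\<close>
  have lead: "coeff (R 0 (Suc n)) (Suc n) = 0"
    unfolding coeff_R_lead prod.lessThan_Suc_shift using dn0 by simp
  have "R 0 (Suc n) = 0"
  proof (rule OPS_nondegenerate [OF P, where k = "Suc n"])
    show "\<forall>j\<ge>Suc n. coeff (R 0 (Suc n)) j = 0"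
      using lead by (metis coeff_R_above le_less)
  qed (rule R_orthogonal)
  then have van: "U (Suc n) ((cdiff ^^ Suc n) g) = 0" for g
    using U_funpow_cdiff [of 0 "Suc n" g] by (simp del: R.simps U.simps(2) funpow.simps)
  have "U (Suc n) g = 0" for g
    using surj_funpow_cdiff [of g "Suc n"] van by metis
  moreover obtain p t where p: "p \<noteq> 0" "\<And>g. U (Suc n) g = L (p * translate t g)"
    using U_as_product [OF nz] by blast
  ultimately have all: "L (p * translate t g) = 0" for g by simp
  have "p = 0"
  proof (rule OPS_nondegenerate [OF P, where k = "Suc (degree p)"])
    show "L (p * g) = 0" for g using all [of "translate (- t) g"] by simp
  qed (simp add: coeff_eq_0)
  with p(1) show False ..
qed

text \<open>\<open>L\<close> kills every \<open>raise 0 q\<close>. When no \<open>dn n\<close>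
  vanishes, these polynomials have every degree from 1 on, so \<open>L\<close> is determined by its
  value at 1.\<close>

lemma L_one_nonzero:
  assumes "L \<noteq> (\<lambda>_. 0)" and dn: "\<And>n. dn (int n) \<noteq> 0"
  shows "L 1 \<noteq> 0"
proof
  assume L1: "L 1 = 0"
  have "L p = 0" if "\<forall>j\<ge>k. coeff p j = 0" for p k
    using that
  proof (induction k arbitrary: p)
    case 0
    then have "p = 0" by (simp add: poly_eqI)
    then show ?case by simp
  next
    case (Suc k)
    show ?case
    proof (cases k)
      case 0
      then have "p = [:coeff p 0:]"
        using Suc.prems by (intro poly_eqI) (auto simp: coeff_pCons split: nat.splits)
      then show ?thesis using const [of "coeff p 0"] L1 by simp
    next
      case (Suc m)
      \<comment> \<open>Chosen so that \<open>raise 0 q\<close> has the same coefficient as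
        \<open>p\<close> at \<open>k = m + 1\<close>.\<close>
      define q where "q = monom (coeff p k / dn (int m)) m"
      have q: "coeff q j = 0" if "j > m" for j using that by (simp add: q_def)
      have "coeff (p - raise 0 q) j = 0" if "j \<ge> k" for j
      proof (cases "j = k")
        case True
        then show ?thesis
          using coeff_raise_top(2) [where k = 0, OF q] Suc dn [of m]
          by (simp add: q_def)
      next
        case False
        then show ?thesis
          using coeff_raise_top(1) [where k = 0, OF q] Suc that Suc.prems by simp
      qed
      then have "L (p - raise 0 q) = 0" by (intro Suc.IH) simp
      moreover have "L (raise 0 q) = 0"
        using U_Suc_cdiff [of 0 q 1] by simp
      ultimately show ?thesis by (simp add: diff)
    qed
  qed
  then have "L p = 0" for p by (meson coeff_eq_0 less_eq_Suc_le)
  with assms(1) show False by blast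
qed

section \<open>The monic orthogonal polynomials and their norms\<close>

definition lead :: "nat \<Rightarrow> complex" where
  "lead n = (\<Prod>i<n. dn (int n - 1 + int i))"

definition monic_R :: "nat \<Rightarrow> complex poly" where
  "monic_R n = smult (inverse (lead n)) (R 0 n)"

context
  assumes dn_nonzero: "\<And>n. dn (int n) \<noteq> 0"
begin

lemma dn_nonzero_int: "i \<ge> 0 \<Longrightarrow> dn i \<noteq> 0"
  using dn_nonzero [of "nat i"] by simp

lemma lead_nonzero: "lead n \<noteq> 0"
  by (auto simp: lead_def dn_nonzero_int)

lemma coeff_monic_R: "coeff (monic_R n) n = 1"
  using lead_nonzero by (simp add: monic_R_def coeff_R_lead flip: lead_def)

lemma coeff_monic_R_above: "j > n \<Longrightarrow> coeff (monic_R n) j = 0"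
  by (simp add: monic_R_def coeff_R_above)

lemma degree_monic_R: "degree (monic_R n) = n"
  by (intro antisym degree_le le_degree) (auto simp: coeff_monic_R coeff_monic_R_above)

lemma coeff_monic_R_second:
  "coeff (monic_R (Suc n)) n = of_nat (Suc n) * en (int n) / dn (2 * int n)"
proof -
  have "coeff (R 0 (Suc n)) n * dn (2 * int n) = of_nat (Suc n) * en (int n) * lead (Suc n)"
    using coeff_R_second [of 0 n] coeff_R_lead [of 0 "Suc n"]
    by (simp add: lead_def del: R.simps)
  then show ?thesis
    using lead_nonzero [of "Suc n"] dn_nonzero_int [of "2 * int n"]
    by (simp add: monic_R_def field_simps del: R.simps)
qed

definition norm2 :: "nat \<Rightarrow> complex" where
  "norm2 n = fact n * U n 1 / lead n"

lemma monic_R_norm: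
  assumes "\<And>j. j > n \<Longrightarrow> coeff g j = 0"
  shows "L (monic_R n * g) = norm2 n * coeff g n"
  using R_norm [OF assms] by (simp add: monic_R_def smult norm2_def field_simps)

lemma monic_R_orthogonal:
  assumes "\<forall>j\<ge>n. coeff g j = 0"
  shows "L (monic_R n * g) = 0"
  using monic_R_norm [of n g] assms by simp

lemma is_monic_OPS_monic_R:
  assumes "\<And>n. norm2 n \<noteq> 0"
  shows "is_monic_OPS L monic_R"
proof -
  have "L (monic_R n * monic_R k) = (if n = k then norm2 n else 0)" for n k
  proof (cases n k rule: linorder_cases)
    case less
    then have "L (monic_R k * monic_R n) = 0"
      by (intro monic_R_orthogonal) (simp add: coeff_monic_R_above)
    then show ?thesis using less by (simp add: mult.commute)
  next
    case equal
    then show ?thesis by (simp add: monic_R_norm coeff_monic_R_above coeff_monic_R)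
  next
    case greater
    then show ?thesis
      by (simp add: monic_R_orthogonal coeff_monic_R_above)
  qed
  then show ?thesis
    using assms unfolding is_monic_OPS_def is_OPS_def
    by (auto simp: degree_monic_R coeff_monic_R intro!: exI [of _ norm2])
qed

text \<open>A zero norm would make \<open>monic_R n\<close> orthogonal to all polynomials of degree
  at most \<open>n\<close>, hence zero.\<close>

lemma norm2_nonzero_if_regular:
  assumes "regular L" shows "norm2 n \<noteq> 0"
proof
  assume 0: "norm2 n = 0"
  obtain P where P: "is_OPS L P" using assms by (auto simp: regular_def)
  have "monic_R n = 0"
  proof (rule OPS_nondegenerate [OF P, where k = "Suc n"])
    show "L (monic_R n * g) = 0" if "\<forall>j\<ge>Suc n. coeff g j = 0" for g
      using monic_R_norm [of n g] that 0 by simp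
  qed (simp add: coeff_monic_R_above)
  then show False using coeff_monic_R [of n] by simp
qed

lemma U_Suc_one':
  "U (Suc n) 1 = - dn (2 * int n) / dn (2 * int n + 1)
     * poly (Phi n) (- en (int n) / dn (2 * int n)) * U n 1"
  using U_Suc_one [of n] dn_nonzero_int [of "2 * int n"] dn_nonzero_int [of "2 * int n + 1"]
  by (simp add: field_simps del: U.simps)

lemma norm2_nonzero_iff:
  assumes "L 1 \<noteq> 0"
  shows "(\<forall>n. norm2 n \<noteq> 0)
    \<longleftrightarrow> (\<forall>n. poly (Phi n) (- en (int n) / dn (2 * int n)) \<noteq> 0)"
proof -
  have iff: "norm2 n \<noteq> 0 \<longleftrightarrow> U n 1 \<noteq> 0" for n
    using lead_nonzero by (simp add: norm2_def)
  have step: "U (Suc n) 1 \<noteq> 0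
      \<longleftrightarrow> poly (Phi n) (- en (int n) / dn (2 * int n)) \<noteq> 0 \<and> U n 1 \<noteq> 0" for n
    unfolding U_Suc_one' using dn_nonzero_int [of "2 * int n"] dn_nonzero_int [of "2 * int n + 1"]
    by simp
  show ?thesis unfolding iff
  proof
    assume "\<forall>n. U n 1 \<noteq> 0"
    then show "\<forall>n. poly (Phi n) (- en (int n) / dn (2 * int n)) \<noteq> 0" using step by blast
  next
    assume *: "\<forall>n. poly (Phi n) (- en (int n) / dn (2 * int n)) \<noteq> 0"
    show "\<forall>n. U n 1 \<noteq> 0"
    proof
      show "U n 1 \<noteq> 0" for n
      proof (induction n)
        case 0
        show ?case using assms by simp
      next
        case (Suc n)
        then show ?case unfolding step using * by blast
      qed
    qed
  qed
qed

lemma poly_Phi: "poly (Phi n) x = poly [:c, b, a:] x + of_nat n * dn (int n)"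
  by (simp add: Phi_def)

text \<open>This identifies \<open>C_coef\<close> as the ratio of consecutive norms. The case
  \<open>n = 0\<close> is separate because \<open>dn (- 1)\<close> may vanish.\<close>

lemma norm2_Suc: "norm2 (Suc n) = C_coef a b c d e (Suc n) * norm2 n"
proof (cases n)
  case 0
  have "dn 0 \<noteq> 0" using dn_nonzero [of 0] by simp
  then show ?thesis
    unfolding norm2_def U_Suc_one' unfolding 0 poly_Phi
    by (simp add: lead_def lin_seq_def del: poly_pCons)
next
  case (Suc m)
  \<comment> \<open>Both sides are the product of the values of \<open>dn\<close> from
    \<open>n - 1\<close> to \<open>2 * n\<close>.\<close>
  have shift: "lead (Suc n) * dn (int n - 1)
      = lead n * dn (2 * int n - 1) * dn (2 * int n)"
  proof -
    have "lead (Suc n) * dn (int n - 1) = (\<Prod>i<Suc (Suc n). dn (int n - 1 + int i))"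
      unfolding prod.lessThan_Suc_shift [of _ "Suc n"] lead_def by (simp add: algebra_simps)
    also have "\<dots> = lead n * dn (2 * int n - 1) * dn (2 * int n)"
      unfolding lead_def by (simp add: algebra_simps)
    finally show ?thesis .
  qed
  have nz: "dn (int n - 1) \<noteq> 0" "dn (2 * int n - 1) \<noteq> 0" "dn (2 * int n) \<noteq> 0"
    "dn (2 * int n + 1) \<noteq> 0"
    using Suc by (auto intro!: dn_nonzero_int)
  then have lead_eq: "lead (Suc n) = lead n * dn (2 * int n - 1) * dn (2 * int n) / dn (int n - 1)"
    using shift by (simp add: field_simps)
  have C_eq: "C_coef a b c d e (Suc n)
      = - (of_nat (n + 1) * dn (int n - 1) / (dn (2 * int n - 1) * dn (2 * int n + 1)))
         * poly (Phi n) (- en (int n) / dn (2 * int n))"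
    using Suc by (simp add: Let_def poly_Phi del: poly_pCons)
  show ?thesis
    unfolding norm2_def U_Suc_one' fact_Suc lead_eq C_eq
    using nz lead_nonzero [of n] by (simp add: field_simps del: U.simps)
qed

section \<open>The three-term recurrence and the Rodrigues formula\<close>

lemma monic_R_recurrence:
  assumes reg: "regular L"
  shows "monic_R (n + 1) = [:- B_coef a b d e n, 1:] * monic_R n
    - smult (C_coef a b c d e n) (if n = 0 then 0 else monic_R (n - 1))"
proof -
  obtain P where P: "is_OPS L P" using reg by (auto simp: regular_def)
  have dn0: "dn 0 = d" "en 0 = e" by (simp_all add: lin_seq_def)
  have R1: "coeff (monic_R (Suc 0)) 0 = - B_coef a b d e 0"
    using coeff_monic_R_second [of 0] by (simp add: B_coef_def dn0)
  show ?thesis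
  proof (cases n)
    case 0
    have "monic_R 0 = 1" by (simp add: monic_R_def lead_def)
    moreover have "monic_R 1 = [:- B_coef a b d e 0, 1:]"
    proof (rule poly_eqI)
      show "coeff (monic_R 1) j = coeff [:- B_coef a b d e 0, 1:] j" for j
        using R1 coeff_monic_R [of 1] coeff_monic_R_above [of 1 j]
        by (cases "j > 1") (auto simp: coeff_pCons split: nat.splits)
    qed
    ultimately show ?thesis using 0 by simp
  next
    case (Suc m)
    \<comment> \<open>The defect of the recurrence: \<open>B_coef\<close> pushes its degree below
      \<open>n\<close>, and \<open>C_coef\<close> makes it orthogonal to all polynomials of degree
      below \<open>n\<close>.\<close>
    define X where "X = monic_R (Suc n) - [:- B_coef a b d e n, 1:] * monic_R n
      + smult (C_coef a b c d e n) (monic_R m)"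
    have X: "coeff X (Suc j) = coeff (monic_R (Suc n)) (Suc j)
        + B_coef a b d e n * coeff (monic_R n) (Suc j) - coeff (monic_R n) j
        + C_coef a b c d e n * coeff (monic_R m) (Suc j)" for j
      by (simp add: X_def del: C_coef.simps)
    have B: "B_coef a b d e n
        = coeff (monic_R n) m - coeff (monic_R (Suc n)) n"
      unfolding coeff_monic_R_second Suc by (simp add: B_coef_def Let_def)
    have "X = 0"
    proof (rule OPS_nondegenerate [OF P, where k = n])
      show "\<forall>j\<ge>n. coeff X j = 0"
      proof (intro allI impI)
        fix j assume "j \<ge> n"
        then obtain i where i: "j = Suc i" "i \<ge> m" using Suc by (metis Suc_le_D Suc_le_mono)
        consider "i = m" | "i = n" | "i > n" using i Suc by linarith
        then show "coeff X j = 0"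
        proof cases
          case 1
          then show ?thesis unfolding i X B using Suc
            by (simp add: coeff_monic_R coeff_monic_R_above)
        next
          case 2
          then show ?thesis unfolding i X using Suc
            by (simp add: coeff_monic_R coeff_monic_R_above)
        next
          case 3
          then show ?thesis unfolding i X using Suc
            by (simp add: coeff_monic_R_above)
        qed
      qed
    next
      fix g :: "complex poly" assume g: "\<forall>j\<ge>n. coeff g j = 0"
      have "L (monic_R (Suc n) * g) = 0" "L (monic_R n * g) = 0"
        using g by (auto intro!: monic_R_orthogonal)
      \<comment> \<open>The factor \<open>z\<close> is moved onto \<open>g\<close>; this
        contribution cancels against the \<open>C_coef\<close> term, since \<open>C_coef\<close> at
        \<open>n\<close> is \<open>norm2 n / norm2 m\<close>.\<close>
      moreover have "L (monic_R n * pCons 0 g) = norm2 n * coeff g m"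
        using g Suc by (subst monic_R_norm) (auto simp: coeff_pCons split: nat.splits)
      moreover have "L (monic_R m * g) = norm2 m * coeff g m"
        using g Suc by (intro monic_R_norm) simp
      moreover have "X * g = monic_R (Suc n) * g + smult (B_coef a b d e n) (monic_R n * g)
          - monic_R n * pCons 0 g + smult (C_coef a b c d e n) (monic_R m * g)"
        by (simp add: X_def algebra_simps)
      ultimately show "L (X * g) = 0"
        using norm2_Suc [of m] Suc by (simp add: add diff smult del: C_coef.simps)
    qed
    then show ?thesis using Suc by (simp add: X_def algebra_simps del: C_coef.simps)
  qed
qed

lemma inverse_lead: "(- 1) ^ n * inverse (lead n) = k_coef a d n"
proof -
  have "lead n = (\<Prod>j=1..n. dn (int n + int j - 2))"
    unfolding lead_def
    by (rule prod.reindex_bij_witness [of _ "\<lambda>j. j - 1" Suc]) (auto simp: algebra_simps)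
  then show ?thesis by (simp add: k_coef_def prod_inversef [symmetric] o_def)
qed

text \<open>The two signs cancel: one is part of \<open>k_coef\<close>, the other will come from
  \<open>n\<close> applications of \<open>DF\<close>.\<close>

lemma monic_R_rodrigues:
  "L (monic_R n * g) = k_coef a d n * ((- 1) ^ n * U n ((cdiff ^^ n) g))"
proof -
  have "L (monic_R n * g) = inverse (lead n) * U n ((cdiff ^^ n) g)"
    using U_funpow_cdiff [of 0 n g] by (simp add: monic_R_def smult)
  then show ?thesis by (simp add: inverse_lead [symmetric] power_mult_distrib [symmetric])
qed

end

lemma regular_iff:
  assumes "L \<noteq> (\<lambda>_. 0)" and nz: "[:c, b, a:] \<noteq> 0 \<or> [:e, d:] \<noteq> 0"
  shows "regular L \<longleftrightarrow> (\<forall>n::nat. dn (int n) \<noteq> 0 \<and>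
    poly [:c, b, a:] (- en (int n) / dn (2 * int n)) + of_nat n * dn (int n) \<noteq> 0)"
    (is "_ \<longleftrightarrow> (\<forall>n. _ \<and> ?phi n \<noteq> 0)")
proof
  assume reg: "regular L"
  have dn: "dn (int n) \<noteq> 0" for n using regular_imp_dn_nonzero [OF reg nz] .
  note norm2_nonzero_if_regular [OF dn reg]
  then have "?phi n \<noteq> 0" for n
    using norm2_nonzero_iff [OF dn L_one_nonzero [OF assms(1) dn]] unfolding poly_Phi [OF dn]
    by blast
  with dn show "\<forall>n. dn (int n) \<noteq> 0 \<and> ?phi n \<noteq> 0" by blast
next
  assume *: "\<forall>n. dn (int n) \<noteq> 0 \<and> ?phi n \<noteq> 0"
  then have dn: "dn (int n) \<noteq> 0" for n by blast
  have "norm2 n \<noteq> 0" for n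
    using * norm2_nonzero_iff [OF dn L_one_nonzero [OF assms(1) dn]] unfolding poly_Phi [OF dn]
    by blast
  from is_monic_OPS_monic_R [OF dn this] show "regular L"
    by (auto simp: regular_def is_monic_OPS_def)
qed

end

section \<open>Reduction from the bi-lattice\<close>

text \<open>In the coordinate \<open>z - \<gamma> \<epsilon>\<close> the operators lose their dependence on \<open>\<gamma>\<close> and only
  flip the sign. \<open>unfold_at \<gamma> k s\<close> reads off a polynomial at the sign reached from \<open>s\<close> after
  \<open>k\<close> flips, in the coordinate of \<open>s\<close>.\<close>

definition unfold_at :: "complex \<Rightarrow> nat \<Rightarrow> sign \<Rightarrow> hpoly \<Rightarrow> complex poly" where
  "unfold_at \<gamma> k s f =
     (if even k then slice f s else translate (- 2 * \<gamma> * sign_val s) (slice f (flip s)))"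

lemma flip_flip [simp]: "flip (flip s) = s"
  by (cases s) simp_all

lemma sign_val_flip [simp]: "sign_val (flip s) = - sign_val s"
  by (cases s) simp_all

lemma slice_emb [simp]: "slice (emb p) s = p"
  by (rule poly_eqI) (simp add: coeff_slice emb_def cst_def coeff_map_poly zero_fun_def)

lemma unfold_at_add: "unfold_at \<gamma> k s (f + g) = unfold_at \<gamma> k s f + unfold_at \<gamma> k s g"
  by (simp add: unfold_at_def slice_add translate_add)

lemma unfold_at_mult: "unfold_at \<gamma> k s (f * g) = unfold_at \<gamma> k s f * unfold_at \<gamma> k s g"
  by (simp add: unfold_at_def slice_mult translate_mult)

text \<open>The recentring in \<open>unfold_at\<close> absorbs the offset
  \<open>- 2 * \<gamma> * \<epsilon>\<close>, whose sign alternates with the flips, and only the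
  translation by \<open>t\<close> remains.\<close>

lemma unfold_at_shift: "unfold_at \<gamma> k s (shift \<gamma> t f) = translate t (unfold_at \<gamma> (Suc k) s f)"
proof -
  have "slice (shift \<gamma> t f) s = translate (- 2 * \<gamma> * sign_val s + t) (slice f (flip s))" for s
    by (simp add: slice_shift translate_def)
  then show ?thesis by (simp add: unfold_at_def add.commute)
qed

lemma unfold_at_D_op: "unfold_at \<gamma> k s (D_op \<gamma> f) = cdiff (unfold_at \<gamma> (Suc k) s f)"
proof -
  have "unfold_at \<gamma> k s (D_op \<gamma> f)
      = smult (1/2) (unfold_at \<gamma> k s (shift \<gamma> 1 f) - unfold_at \<gamma> k s (shift \<gamma> (- 1) f))"
    by (simp add: D_op_def unfold_at_def slice_smult slice_diff translate_diff translate_smult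
        cst_def)
  then show ?thesis by (simp only: unfold_at_shift cdiff_def)
qed

lemma unfold_at_S_op: "unfold_at \<gamma> k s (S_op \<gamma> f) = cmean (unfold_at \<gamma> (Suc k) s f)"
proof -
  have "unfold_at \<gamma> k s (S_op \<gamma> f)
      = smult (1/2) (unfold_at \<gamma> k s (shift \<gamma> 1 f) + unfold_at \<gamma> k s (shift \<gamma> (- 1) f))"
    by (simp add: S_op_def unfold_at_def slice_smult slice_add translate_add translate_smult
        cst_def)
  then show ?thesis by (simp only: unfold_at_shift cmean_def)
qed

lemma unfold_at_Suc_Suc: "unfold_at \<gamma> (Suc (Suc k)) s f = unfold_at \<gamma> k s f"
  by (simp add: unfold_at_def)

lemma unfold_at_funpow_D_op:
  "unfold_at \<gamma> k s ((D_op \<gamma> ^^ n) f) = (cdiff ^^ n) (unfold_at \<gamma> (k + n) s f)"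
  by (induction n arbitrary: k) (simp_all add: unfold_at_D_op)

lemma unfold_at_twice: "unfold_at \<gamma> (n + n) s f = slice f s"
  by (simp add: unfold_at_def)

lemma funpow_DF: "(DF \<gamma> ^^ n) v f s = (- 1) ^ n * v ((D_op \<gamma> ^^ n) f) s"
proof (induction n arbitrary: f)
  case (Suc n)
  have "(DF \<gamma> ^^ Suc n) v f s = - (DF \<gamma> ^^ n) v (D_op \<gamma> f) s" by (simp add: DF_def)
  then show ?case using Suc by (simp add: funpow_swap1)
qed simp

lemma pearson_functional_if_bilattice:
  assumes "poly_functional u"
    and eq: "DF \<gamma> (mulF (emb [:c, b, a:]) (ext u)) = SF \<gamma> (mulF (emb [:e, d:]) (ext u))"
  shows "pearson_functional u a b c d e"
proof -
  interpret poly_functional u by fact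
  have at: "u (slice f s) = u (unfold_at \<gamma> 0 s f)" for f s by (simp add: unfold_at_def)
  have emb: "unfold_at \<gamma> 0 s (emb p) = p" for p s by (simp add: unfold_at_def)
  show ?thesis
  proof unfold_locales
    fix g
    \<comment> \<open>Translating \<open>g\<close> beforehand undoes the recentring seen from
      \<open>PosS\<close>, so that an arbitrary \<open>g\<close> is reached.\<close>
    define f where "f = emb (translate (2 * \<gamma>) g)"
    have f: "unfold_at \<gamma> (Suc 0) PosS f = g" by (simp add: f_def unfold_at_def)
    from fun_cong [OF fun_cong [OF eq, of f], of PosS]
    have "- u ([:c, b, a:] * cdiff g) = u ([:e, d:] * cmean g)"
      by (simp only: DF_def SF_def mulF_def ext_def fun_Compl_def at unfold_at_mult emb
          unfold_at_D_op unfold_at_S_op f)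
    then show "u ([:c, b, a:] * cdiff g) + u ([:e, d:] * cmean g) = 0"
      by (metis add.right_inverse)
  qed
qed

context pearson_functional
begin

text \<open>Each application of \<open>D_op\<close> or \<open>S_op\<close> flips the sign once, so
  the \<open>k\<close>-th iterates are read off after \<open>k\<close> flips, and the result depends
  neither on \<gamma> nor on \<open>s\<close>.\<close>

lemma unfold_at_phi_psi_it:
  "unfold_at \<gamma> k s (phi_it \<gamma> (emb [:c, b, a:]) (emb [:e, d:]) k) = Phi k \<and>
   unfold_at \<gamma> k s (psi_it \<gamma> (emb [:c, b, a:]) (emb [:e, d:]) k) = Psi k"
proof (induction k)
  case 0
  show ?case by (simp add: unfold_at_def Phi_def Psi_def lin_seq_def)
next
  case (Suc k)
  then show ?case
    by (simp add: unfold_at_add unfold_at_D_op unfold_at_S_op unfold_at_Suc_Suc Phi_Suc Psi_Suc)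
qed

lemma u_it_eq:
  "u_it \<gamma> (emb [:c, b, a:]) (emb [:e, d:]) (ext L) k f s = U k (unfold_at \<gamma> k s f)"
proof (induction k arbitrary: f)
  case 0
  show ?case by (simp add: ext_def unfold_at_def)
next
  case (Suc k)
  then show ?case
    by (simp add: DF_def SF_def mulF_def unfold_at_mult unfold_at_phi_psi_it unfold_at_D_op
        unfold_at_S_op)
qed

lemma rodrigues:
  assumes "\<And>n. dn (int n) \<noteq> 0"
  shows "mulF (emb (monic_R n)) (ext L) = scaleF (k_coef a d n)
    ((DF \<gamma> ^^ n) (u_it \<gamma> (emb [:c, b, a:]) (emb [:e, d:]) (ext L) n))"
proof (intro ext)
  fix f s
  have "mulF (emb (monic_R n)) (ext L) f s = L (monic_R n * slice f s)"
    by (simp add: mulF_def ext_def slice_mult)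
  also have "\<dots> = k_coef a d n * ((- 1) ^ n * U n ((cdiff ^^ n) (slice f s)))"
    by (rule monic_R_rodrigues [OF assms])
  \<comment> \<open>\<open>u_it\<close> at level \<open>n\<close> and the \<open>n\<close>
    applications of \<open>D_op\<close> contribute \<open>n\<close> flips each; after an even number
    of flips \<open>unfold_at\<close> is the plain \<open>slice f s\<close>.\<close>
  also have "\<dots> = scaleF (k_coef a d n)
      ((DF \<gamma> ^^ n) (u_it \<gamma> (emb [:c, b, a:]) (emb [:e, d:]) (ext L) n)) f s"
    by (simp add: scaleF_def cst_def funpow_DF u_it_eq unfold_at_funpow_D_op unfold_at_twice)
  finally show "mulF (emb (monic_R n)) (ext L) f s = \<dots>" .
qed

end

theorem theorem1p1:
  fixes \<gamma> a b c d e :: complex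
    and u :: "complex poly \<Rightarrow> complex"
    and \<phi> \<psi> :: "complex poly"
    and dn en :: "int \<Rightarrow> complex"
  assumes u_dual: "u \<in> alg_dual"
    and u_nonzero: "u \<noteq> (\<lambda>_. 0)"
    and phi: "\<phi> = [:c, b, a:]"
    and psi: "\<psi> = [:e, d:]"
    and nontrivial: "(\<phi>, \<psi>) \<noteq> (0, 0)"
    and functional_eq: "DF \<gamma> (mulF (emb \<phi>) (ext u)) = SF \<gamma> (mulF (emb \<psi>) (ext u))"
    and dn: "dn = lin_seq a d"
    and en: "en = lin_seq b e"
  shows
    "(regular u \<longleftrightarrow>
        (\<forall>n::nat. dn (int n) \<noteq> 0 \<and>
           poly \<phi> (- en (int n) / dn (2 * int n)) + of_nat n * dn (int n) \<noteq> 0)) \<and>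
     (regular u \<longrightarrow>
        (\<exists>!P. is_monic_OPS u P) \<and>
        (\<forall>P. is_monic_OPS u P \<longrightarrow>
           P 0 = 1 \<and>
           (\<forall>n::nat. P (n + 1) =
              [:- B_coef a b d e n, 1:] * P n
              - smult (C_coef a b c d e n) (if n = 0 then 0 else P (n - 1))) \<and>
           (\<forall>n::nat. mulF (emb (P n)) (ext u) =
              scaleF (k_coef a d n)
                ((DF \<gamma> ^^ n) (u_it \<gamma> (emb \<phi>) (emb \<psi>) (ext u) n)))))"
proof -
  have "Vector_Spaces.linear smult (*) u" using u_dual by (simp add: alg_dual_def)
  then interpret lin: Vector_Spaces.linear smult "(*)" u .
  have "poly_functional u" by unfold_locales (simp_all add: lin.add lin.scale)
  then interpret pearson_functional u a b c d e
    using functional_eq unfolding phi psi by (rule pearson_functional_if_bilattice)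
  have nz: "[:c, b, a:] \<noteq> 0 \<or> [:e, d:] \<noteq> 0" using nontrivial phi psi by auto
  have iff: "regular u \<longleftrightarrow> (\<forall>n::nat. dn (int n) \<noteq> 0 \<and>
      poly \<phi> (- en (int n) / dn (2 * int n)) + of_nat n * dn (int n) \<noteq> 0)"
    unfolding phi dn en by (rule regular_iff [OF u_nonzero nz])
  have "(\<exists>!P. is_monic_OPS u P) \<and>
      (\<forall>P. is_monic_OPS u P \<longrightarrow> P 0 = 1 \<and>
        (\<forall>n::nat. P (n + 1) = [:- B_coef a b d e n, 1:] * P n
            - smult (C_coef a b c d e n) (if n = 0 then 0 else P (n - 1))) \<and>
        (\<forall>n::nat. mulF (emb (P n)) (ext u) =
            scaleF (k_coef a d n)
              ((DF \<gamma> ^^ n) (u_it \<gamma> (emb \<phi>) (emb \<psi>) (ext u) n))))"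
    if reg: "regular u"
  proof -
    have d: "lin_seq a d (int n) \<noteq> 0" for n using regular_imp_dn_nonzero [OF reg nz] .
    have OPS: "is_monic_OPS u monic_R"
      by (rule is_monic_OPS_monic_R [OF d norm2_nonzero_if_regular [OF d reg]])
    have "P = monic_R" if "is_monic_OPS u P" for P
      using monic_OPS_unique [OF that OPS] .
    moreover have "monic_R 0 = 1" by (simp add: monic_R_def lead_def)
    ultimately show ?thesis
      using OPS monic_R_recurrence [OF d reg] rodrigues [OF d] unfolding phi psi by blast
  qed
  with iff show ?thesis by blast
qed

end
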